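(* Let $S$ be the unique formal power series in the variables $t_1,t_2,\dots$ satisfying $S=1+\sum_{n=1}^\infty t_nS^n$, let $S_1=\sum_{n=1}^\infty t_n$, and define $G=(S-1)/S_1$ and $H=G/S$ in the field of fractions of the ring of formal power series in $t_1,t_2,\dots$. Then $$S=\biggl(1-\sum_{n=1}^{\infty} t_nS^{n-1}\biggr)^{-1}=\frac{1}{1-HS_1},$$ $$G=\biggl(1-\sum_{n=1}^\infty t_n\,(1+S+S^2+\cdots+S^{n-1})\biggr)^{-1},$$ and $$H=\biggl(1-\sum_{n=2}^\infty t_n\,(S+S^2+\cdots+S^{n-1})\biggr)^{-1}.$$
   Context: Formal power series are in infinitely many commuting variables $t_1,t_2,\dots$ (coefficients in the integers or the rationals); a formal power series is an arbitrary, possibly infinite, formal linear combination of monomials in the $t_i$ (each monomial involving finitely many variables), so that for instance $\sum_{n\ge1}t_n$ is a formal power series. This ring is an integral domain, so quotients by nonzero power series make sense in its field of fractions, where $G$ and $H$ are defined a priori. Infinite sums are understood coefficientwise. The equation $S=1+\sum_{n\ge 1}t_nS^n$ has a unique formal power series solution $S$. *)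

theory Defs
  imports
    "HOL-Library.Poly_Mapping"
    "HOL-Computational_Algebra.Polynomial_Factorial"
begin

text \<open>
  The variables are \<open>t\<^sub>1, t\<^sub>2, \<dots>\<close>.  A monomial is a finitely supported exponent vector
  \<open>m :: nat \<Rightarrow>\<^sub>0 nat\<close>, where \<open>lookup m i\<close> is the exponent of \<open>t\<^sub>i\<^sub>+\<^sub>1\<close>; the shift by one
  ensures that there is no superfluous variable \<open>t\<^sub>0\<close>.  A series is an arbitrary coefficient
  function on monomials.
\<close>

typedef 'a mfps = "UNIV :: ((nat \<Rightarrow>\<^sub>0 nat) \<Rightarrow> 'a) set"
  morphisms mcoeff Abs_mfps
  by simp

lemma mcoeff_Abs [simp]: "mcoeff (Abs_mfps f) = f"
  by (simp add: Abs_mfps_inverse)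

lemma mfps_eq_iff: "f = g \<longleftrightarrow> (\<forall>m. mcoeff f m = mcoeff g m)"
  by (metis ext mcoeff_inject)

lemma mfps_eqI: "(\<And>m. mcoeff f m = mcoeff g m) \<Longrightarrow> f = g"
  by (simp add: mfps_eq_iff)

definition splits :: "(nat \<Rightarrow>\<^sub>0 nat) \<Rightarrow> ((nat \<Rightarrow>\<^sub>0 nat) \<times> (nat \<Rightarrow>\<^sub>0 nat)) set"
  where "splits m = {(a, b). a + b = m}"

lemma finite_splits [simp]: "finite (splits m)"
proof -
  let ?B = "{..Max (insert 0 (Poly_Mapping.lookup m ` Poly_Mapping.keys m))}"
  let ?F = "{f. \<forall>x. (x \<in> Poly_Mapping.keys m \<longrightarrow> f x \<in> ?B) \<and> (x \<notin> Poly_Mapping.keys m \<longrightarrow> f x = (0::nat))}"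
  have fin: "finite ?F"
    by (rule finite_set_of_finite_funs) auto
  have "Poly_Mapping.lookup a \<in> ?F" if "a + b = m" for a b
  proof -
    have le: "Poly_Mapping.lookup a x \<le> Poly_Mapping.lookup m x" for x
      using that by (auto simp: lookup_add)
    show ?thesis
    proof (clarsimp, intro conjI impI)
      fix x assume "x \<in> Poly_Mapping.keys m"
      then have "Poly_Mapping.lookup m x \<le> Max (insert 0 (Poly_Mapping.lookup m ` Poly_Mapping.keys m))"
        by (intro Max_ge) auto
      with le[of x] show "Poly_Mapping.lookup a x \<le> Max (insert 0 (Poly_Mapping.lookup m ` Poly_Mapping.keys m))"
        by linarith
    next
      fix x assume "x \<notin> Poly_Mapping.keys m"
      then show "Poly_Mapping.lookup a x = 0"
        using le[of x] by (simp add: in_keys_iff)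
    qed
  qed
  then have "Poly_Mapping.lookup ` fst ` splits m \<subseteq> ?F"
    by (auto simp: splits_def)
  then have "finite (Poly_Mapping.lookup ` fst ` splits m)"
    using fin finite_subset by blast
  then have fst: "finite (fst ` splits m)"
    by (rule finite_imageD) (simp add: inj_on_def lookup_inject)
  have "inj_on fst (splits m)"
    by (auto simp: inj_on_def splits_def)
  with fst show ?thesis
    by (rule finite_imageD)
qed

instantiation mfps :: (zero) zero
begin
definition "0 = Abs_mfps (\<lambda>_. 0)"
instance ..
end

instantiation mfps :: ("{zero, one}") one
begin
definition "1 = Abs_mfps (\<lambda>m. if m = 0 then 1 else 0)"
instance ..
end

instantiation mfps :: (plus) plus
begin
definition "f + g = Abs_mfps (\<lambda>m. mcoeff f m + mcoeff g m)"
instance ..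
end

instantiation mfps :: (minus) minus
begin
definition "f - g = Abs_mfps (\<lambda>m. mcoeff f m - mcoeff g m)"
instance ..
end

instantiation mfps :: (uminus) uminus
begin
definition "- f = Abs_mfps (\<lambda>m. - mcoeff f m)"
instance ..
end

instantiation mfps :: ("{comm_monoid_add, times}") times
begin
definition "f * g = Abs_mfps (\<lambda>m. \<Sum>(a, b)\<in>splits m. mcoeff f a * mcoeff g b)"
instance ..
end

lemma mcoeff_0 [simp]: "mcoeff 0 m = 0"
  by (simp add: zero_mfps_def)

lemma mcoeff_1: "mcoeff 1 m = (if m = 0 then 1 else 0)"
  by (simp add: one_mfps_def)

lemma mcoeff_add [simp]: "mcoeff (f + g) m = mcoeff f m + mcoeff g m"
  by (simp add: plus_mfps_def)

lemma mcoeff_diff [simp]: "mcoeff (f - g) m = mcoeff f m - mcoeff g m"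
  by (simp add: minus_mfps_def)

lemma mcoeff_uminus [simp]: "mcoeff (- f) m = - mcoeff f m"
  by (simp add: uminus_mfps_def)

lemma mcoeff_mult: "mcoeff (f * g) m = (\<Sum>(a, b)\<in>splits m. mcoeff f a * mcoeff g b)"
  by (simp add: times_mfps_def)

instance mfps :: (comm_ring_1) comm_ring_1
proof
  fix a b c :: "'a mfps"
  show "a * b * c = a * (b * c)"
  proof (rule mfps_eqI)
    fix m
    have "mcoeff (a * b * c) m =
        (\<Sum>(x, z)\<in>splits m. \<Sum>(u, v)\<in>splits x. mcoeff a u * mcoeff b v * mcoeff c z)"
      by (simp add: mcoeff_mult sum_distrib_right case_prod_unfold)
    also have "\<dots> = (\<Sum>(p, q)\<in>Sigma (splits m) (\<lambda>p. splits (fst p)).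
        mcoeff a (fst q) * mcoeff b (snd q) * mcoeff c (snd p))"
      by (subst sum.Sigma[symmetric]) (auto simp: case_prod_unfold)
    also have "\<dots> = (\<Sum>(p, q)\<in>Sigma (splits m) (\<lambda>p. splits (snd p)).
        mcoeff a (fst p) * mcoeff b (fst q) * mcoeff c (snd q))"
      by (rule sum.reindex_bij_witness
          [where i = "\<lambda>(p, q). ((fst p + fst q, snd q), (fst p, fst q))"
             and j = "\<lambda>(p, q). ((fst q, snd q + snd p), (snd q, snd p))"])
        (auto simp: splits_def add.assoc)
    also have "\<dots> =
        (\<Sum>(x, z)\<in>splits m. \<Sum>(u, v)\<in>splits z. mcoeff a x * (mcoeff b u * mcoeff c v))"
      by (subst sum.Sigma[symmetric]) (auto simp: case_prod_unfold mult.assoc)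
    also have "\<dots> = mcoeff (a * (b * c)) m"
      by (simp add: mcoeff_mult sum_distrib_left case_prod_unfold)
    finally show "mcoeff (a * b * c) m = mcoeff (a * (b * c)) m" .
  qed
  show "a * b = b * a"
  proof (rule mfps_eqI)
    fix m
    show "mcoeff (a * b) m = mcoeff (b * a) m"
      unfolding mcoeff_mult
      by (rule sum.reindex_bij_witness[where i = prod.swap and j = prod.swap])
        (auto simp: splits_def ac_simps)
  qed
  show "1 * a = a"
  proof (rule mfps_eqI)
    fix m
    have "mcoeff (1 * a) m = (\<Sum>(x, y)\<in>{(0, m)}. mcoeff 1 x * mcoeff a y)"
      unfolding mcoeff_mult
      by (rule sum.mono_neutral_right)
        (simp, simp add: splits_def, auto simp: splits_def mcoeff_1 split: if_splits)
    then show "mcoeff (1 * a) m = mcoeff a m"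
      by (simp add: mcoeff_1)
  qed
  show "(a + b) * c = a * c + b * c"
    by (rule mfps_eqI)
      (simp add: mcoeff_mult distrib_right case_prod_unfold sum.distrib)
  show "(0::'a mfps) \<noteq> 1"
    by (auto simp: mfps_eq_iff mcoeff_1)
qed (auto simp: mfps_eq_iff)

definition mdeg :: "(nat \<Rightarrow>\<^sub>0 nat) \<Rightarrow> nat"
  where "mdeg m = (\<Sum>i\<in>Poly_Mapping.keys m. Poly_Mapping.lookup m i)"

lemma mdeg_superset:
  assumes "finite A" "Poly_Mapping.keys m \<subseteq> A"
  shows "mdeg m = (\<Sum>i\<in>A. Poly_Mapping.lookup m i)"
  unfolding mdeg_def using assms
  by (intro sum.mono_neutral_left) (auto simp: in_keys_iff)

lemma keys_add_nat: "Poly_Mapping.keys (a + b) = Poly_Mapping.keys a \<union> Poly_Mapping.keys (b :: nat \<Rightarrow>\<^sub>0 nat)"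
  by (auto simp: in_keys_iff lookup_add)

lemma mdeg_add: "mdeg (a + b) = mdeg a + mdeg b"
  by (simp add: mdeg_superset[of "Poly_Mapping.keys a \<union> Poly_Mapping.keys b"] keys_add_nat lookup_add sum.distrib)

lemma mdeg_single [simp]: "mdeg (Poly_Mapping.single i (Suc 0)) = 1"
  by (simp add: mdeg_def)

lemma finite_mdeg_keys:
  assumes "finite A"
  shows "finite {m. Poly_Mapping.keys m \<subseteq> A \<and> mdeg m = d}"
proof -
  let ?F = "{f. \<forall>x. (x \<in> A \<longrightarrow> f x \<in> {..d}) \<and> (x \<notin> A \<longrightarrow> f x = (0::nat))}"
  have "Poly_Mapping.lookup m x \<le> mdeg m" if "Poly_Mapping.keys m \<subseteq> A" "x \<in> A" for m x
    using that assms by (simp add: mdeg_superset[of A] member_le_sum)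
  then have "Poly_Mapping.lookup ` {m. Poly_Mapping.keys m \<subseteq> A \<and> mdeg m = d} \<subseteq> ?F"
    by (auto simp: in_keys_iff)
  moreover have "finite ?F"
    by (rule finite_set_of_finite_funs) (use assms in auto)
  ultimately have "finite (Poly_Mapping.lookup ` {m. Poly_Mapping.keys m \<subseteq> A \<and> mdeg m = d})"
    by (rule finite_subset)
  then show ?thesis
    by (rule finite_imageD) (simp add: inj_on_def lookup_inject)
qed

text \<open>
  The integral domain property: restrict both factors to the finitely many variables of
  some monomial from each support, and look at the product of their leading monomials,
  those which are least for the graded lexicographic order.
\<close>

lemma ex_least_monomial:
  assumes "finite A" "Poly_Mapping.keys m \<subseteq> A" "mcoeff f m \<noteq> (0::'a::zero)"
  obtains m0 where "Poly_Mapping.keys m0 \<subseteq> A" "mcoeff f m0 \<noteq> 0"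
    "\<And>x. Poly_Mapping.keys x \<subseteq> A \<Longrightarrow> mcoeff f x \<noteq> 0 \<Longrightarrow> mdeg m0 < mdeg x \<or> mdeg m0 = mdeg x \<and> m0 \<le> x"
proof -
  let ?P = "\<lambda>x. Poly_Mapping.keys x \<subseteq> A \<and> mcoeff f x \<noteq> 0"
  define d where "d = (LEAST d. \<exists>x. ?P x \<and> mdeg x = d)"
  have ex: "\<exists>x. ?P x \<and> mdeg x = d"
    unfolding d_def by (rule LeastI_ex) (use assms in blast)
  have d_le: "d \<le> mdeg x" if "?P x" for x
    unfolding d_def by (rule Least_le) (use that in blast)
  let ?X = "{x. ?P x \<and> mdeg x = d}"
  have fin: "finite ?X"
    by (rule finite_subset[OF _ finite_mdeg_keys[OF assms(1), of d]]) auto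
  have "Min ?X \<in> ?X"
    by (rule Min_in[OF fin]) (use ex in auto)
  moreover have "Min ?X \<le> x" if "x \<in> ?X" for x
    using Min_le[OF fin that] .
  ultimately show thesis
    using d_le by (intro that[of "Min ?X"]) (auto simp: order_le_less)
qed

instance mfps :: (idom) idom
proof
  fix f g :: "'a mfps"
  assume "f \<noteq> 0" "g \<noteq> 0"
  then obtain a b where ab: "mcoeff f a \<noteq> 0" "mcoeff g b \<noteq> 0"
    by (auto simp: mfps_eq_iff)
  define A where "A = Poly_Mapping.keys a \<union> Poly_Mapping.keys b"
  have A: "finite A" "Poly_Mapping.keys a \<subseteq> A" "Poly_Mapping.keys b \<subseteq> A"
    by (auto simp: A_def)
  obtain p where p: "Poly_Mapping.keys p \<subseteq> A" "mcoeff f p \<noteq> 0"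
    "\<And>x. Poly_Mapping.keys x \<subseteq> A \<Longrightarrow> mcoeff f x \<noteq> 0 \<Longrightarrow> mdeg p < mdeg x \<or> mdeg p = mdeg x \<and> p \<le> x"
    using ex_least_monomial[OF A(1,2) ab(1)] by blast
  obtain q where q: "Poly_Mapping.keys q \<subseteq> A" "mcoeff g q \<noteq> 0"
    "\<And>x. Poly_Mapping.keys x \<subseteq> A \<Longrightarrow> mcoeff g x \<noteq> 0 \<Longrightarrow> mdeg q < mdeg x \<or> mdeg q = mdeg x \<and> q \<le> x"
    using ex_least_monomial[OF A(1,3) ab(2)] by blast
  have "mcoeff f x * mcoeff g y = 0" if xy: "x + y = p + q" "(x, y) \<noteq> (p, q)" for x y
  proof (rule ccontr)
    assume "mcoeff f x * mcoeff g y \<noteq> 0"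
    then have nz: "mcoeff f x \<noteq> 0" "mcoeff g y \<noteq> 0"
      by auto
    have "Poly_Mapping.keys x \<union> Poly_Mapping.keys y \<subseteq> A"
      using xy(1) p(1) q(1) by (metis keys_add_nat Un_least)
    moreover have deg: "mdeg x + mdeg y = mdeg p + mdeg q"
      using xy(1) by (metis mdeg_add)
    ultimately have le: "p \<le> x" "q \<le> y"
      using p(3)[of x] q(3)[of y] nz by auto
    have "p = x"
    proof (rule ccontr)
      assume "p \<noteq> x"
      then have "p + q < x + y"
        using le by (intro add_less_le_mono) auto
      with xy(1) show False by simp
    qed
    with xy show False by auto
  qed
  then have "mcoeff (f * g) (p + q) = (\<Sum>(x, y)\<in>{(p, q)}. mcoeff f x * mcoeff g y)"
    unfolding mcoeff_mult
    by (intro sum.mono_neutral_right) (simp, simp add: splits_def, force simp: splits_def)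
  also have "\<dots> \<noteq> 0"
    using p(2) q(2) by simp
  finally show "f * g \<noteq> 0"
    by auto
qed

definition tvar :: "nat \<Rightarrow> 'a::zero_neq_one mfps"
  where "tvar n = Abs_mfps (\<lambda>m. if m = Poly_Mapping.single (n - 1) 1 then 1 else 0)"
  \<comment> \<open>\<open>tvar n\<close> is \<open>t\<^sub>n\<close> for \<open>n \<ge> 1\<close>; it is not meant to be used at \<open>n = 0\<close>.\<close>

definition mfps_summable :: "('i \<Rightarrow> 'a::comm_monoid_add mfps) \<Rightarrow> 'i set \<Rightarrow> bool"
  where "mfps_summable F I \<longleftrightarrow> (\<forall>m. finite {i \<in> I. mcoeff (F i) m \<noteq> 0})"

text \<open>
  The coefficientwise sum, only meaningful for summable families.  Families of the form
  \<open>t\<^sub>n F\<^sub>n\<close> are always summable, whatever the series \<open>F\<^sub>n\<close>; see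
  \<open>mfps_summable_tvar_mult\<close>.
\<close>

definition mfps_infsum :: "('i \<Rightarrow> 'a::comm_monoid_add mfps) \<Rightarrow> 'i set \<Rightarrow> 'a mfps"
  where "mfps_infsum F I = Abs_mfps (\<lambda>m. \<Sum>i | i \<in> I \<and> mcoeff (F i) m \<noteq> 0. mcoeff (F i) m)"

lemma mcoeff_infsum:
  "mcoeff (mfps_infsum F I) m = (\<Sum>i | i \<in> I \<and> mcoeff (F i) m \<noteq> 0. mcoeff (F i) m)"
  by (simp add: mfps_infsum_def)

lemma mcoeff_tvar: "mcoeff (tvar n) m = (if m = Poly_Mapping.single (n - 1) 1 then 1 else 0)"
  by (simp add: tvar_def)

lemma mcoeff_tvar_mult_nonzeroD:
  fixes f :: "'a::comm_ring_1 mfps"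
  assumes "mcoeff (tvar n * f) m \<noteq> 0"
  shows "n - 1 \<in> Poly_Mapping.keys m"
proof -
  from assms obtain a b where "(a, b) \<in> splits m" "mcoeff (tvar n) a * mcoeff f b \<noteq> 0"
    unfolding mcoeff_mult by (elim sum.not_neutral_contains_not_neutral) auto
  then show ?thesis
    by (auto simp: splits_def mcoeff_tvar keys_add_nat split: if_splits)
qed

lemma mfps_summable_tvar_mult: "mfps_summable (\<lambda>n. tvar n * F n :: 'a::comm_ring_1 mfps) I"
  unfolding mfps_summable_def
proof
  fix m
  have "{i \<in> I. mcoeff (tvar i * F i) m \<noteq> 0} \<subseteq> insert 0 (Suc ` Poly_Mapping.keys m)"
  proof
    fix i
    assume "i \<in> {i \<in> I. mcoeff (tvar i * F i) m \<noteq> 0}"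
    then have "i - 1 \<in> Poly_Mapping.keys m"
      using mcoeff_tvar_mult_nonzeroD by blast
    then show "i \<in> insert 0 (Suc ` Poly_Mapping.keys m)"
      by (cases i) auto
  qed
  then show "finite {i \<in> I. mcoeff (tvar i * F i) m \<noteq> 0}"
    by (rule finite_subset) simp
qed

lemma mfps_summable_tvar: "mfps_summable (tvar :: nat \<Rightarrow> 'a::comm_ring_1 mfps) I"
  using mfps_summable_tvar_mult[of "\<lambda>_. 1" I] by simp

lemma infsum_tvar_nonzero: "mfps_infsum tvar {1..} \<noteq> (0 :: 'a::comm_ring_1 mfps)"
proof
  assume *: "mfps_infsum tvar {1..} = (0 :: 'a mfps)"
  let ?m = "Poly_Mapping.single 0 1 :: nat \<Rightarrow>\<^sub>0 nat"
  have "?m = Poly_Mapping.single (i - 1) 1 \<longleftrightarrow> i = 1" if "i \<ge> 1" for i :: nat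
    using that by (auto dest!: arg_cong[where f = Poly_Mapping.keys])
  then have "{i. i \<in> {1..} \<and> mcoeff (tvar i :: 'a mfps) ?m \<noteq> 0} = {1}"
    by (auto simp: mcoeff_tvar)
  then have "mcoeff (mfps_infsum tvar {1..} :: 'a mfps) ?m = 1"
    unfolding mcoeff_infsum by (simp add: mcoeff_tvar)
  with * show False by simp
qed

definition agree :: "nat \<Rightarrow> 'a mfps \<Rightarrow> 'a mfps \<Rightarrow> bool"
  where "agree k f g \<longleftrightarrow> (\<forall>m. mdeg m < k \<longrightarrow> mcoeff f m = mcoeff g m)"

lemma agree_mult:
  assumes "agree k f f'" "agree k g g'"
  shows "agree k (f * g) (f' * g' :: 'a::comm_ring_1 mfps)"
  unfolding agree_def mcoeff_mult
proof (intro allI impI sum.cong refl)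
  fix m p
  assume "mdeg m < k" "p \<in> splits m"
  then have "mdeg (fst p) < k" "mdeg (snd p) < k"
    by (auto simp: splits_def mdeg_add)
  with assms show "(case p of (a, b) \<Rightarrow> mcoeff f a * mcoeff g b) =
      (case p of (a, b) \<Rightarrow> mcoeff f' a * mcoeff g' b)"
    by (auto simp: agree_def case_prod_unfold)
qed

lemma agree_power:
  assumes "agree k f g"
  shows "agree k (f ^ n) (g ^ n :: 'a::comm_ring_1 mfps)"
proof (induction n)
  case 0
  show ?case by (simp add: agree_def)
next
  case (Suc n)
  with assms show ?case by (simp add: agree_mult)
qed

lemma agree_tvar_mult:
  assumes "agree k f g"
  shows "agree (Suc k) (tvar n * f) (tvar n * g :: 'a::comm_ring_1 mfps)"
  unfolding agree_def mcoeff_mult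
proof (intro allI impI sum.cong refl)
  fix m p
  assume "mdeg m < Suc k" "p \<in> splits m"
  then show "(case p of (a, b) \<Rightarrow> mcoeff (tvar n) a * mcoeff f b) =
      (case p of (a, b) \<Rightarrow> mcoeff (tvar n) a * mcoeff g b)"
    using assms by (cases p) (auto simp: agree_def splits_def mcoeff_tvar mdeg_add)
qed

lemma agree_infsum:
  assumes "\<And>i. agree k (F i) (G i)"
  shows "agree k (mfps_infsum F I) (mfps_infsum G I)"
  unfolding agree_def
proof (intro allI impI)
  fix m
  assume "mdeg m < k"
  then have "mcoeff (F i) m = mcoeff (G i) m" for i
    using assms by (simp add: agree_def)
  then show "mcoeff (mfps_infsum F I) m = mcoeff (mfps_infsum G I) m"
    by (simp add: mcoeff_infsum)
qed

theorem ex1_functional_equation: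
  "\<exists>!S :: 'a::comm_ring_1 mfps. S = 1 + mfps_infsum (\<lambda>n. tvar n * S ^ n) {1..}"
proof -
  define \<Phi> :: "'a mfps \<Rightarrow> 'a mfps"
    where "\<Phi> f = 1 + mfps_infsum (\<lambda>n. tvar n * f ^ n) {1..}" for f
  have contr: "agree (Suc k) (\<Phi> f) (\<Phi> g)" if "agree k f g" for k f g
  proof -
    have "agree (Suc k) (mfps_infsum (\<lambda>n. tvar n * f ^ n) {1..})
        (mfps_infsum (\<lambda>n. tvar n * g ^ n) {1..})"
      by (intro agree_infsum agree_tvar_mult agree_power that)
    then show ?thesis
      by (simp add: agree_def \<Phi>_def)
  qed
  define s where "s k = (\<Phi> ^^ k) 0" for k
  define S where "S = Abs_mfps (\<lambda>m. mcoeff (s (Suc (mdeg m))) m)"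
  have step: "agree k (s k) (s (Suc k))" for k
  proof (induction k)
    case 0
    show ?case by (simp add: agree_def)
  next
    case (Suc k)
    from contr[OF this] show ?case by (simp add: s_def)
  qed
  have mono: "agree k (s k) (s (k + j))" for k j
  proof (induction j)
    case 0
    show ?case by (simp add: agree_def)
  next
    case (Suc j)
    with step[of "k + j"] show ?case by (auto simp: agree_def)
  qed
  have S: "agree k S (s k)" for k
    unfolding agree_def
  proof (intro allI impI)
    fix m
    assume "mdeg m < k"
    then obtain j where "k = Suc (mdeg m) + j"
      using less_iff_Suc_add by auto
    with mono[of "Suc (mdeg m)" j] show "mcoeff S m = mcoeff (s k) m"
      by (simp add: S_def agree_def)
  qed
  have "S = \<Phi> S"
  proof (rule mfps_eqI)
    fix m
    have "agree (Suc (mdeg m)) (\<Phi> S) (s (Suc (mdeg m)))"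
      using contr[OF S[of "mdeg m"]] by (simp add: s_def)
    then show "mcoeff S m = mcoeff (\<Phi> S) m"
      by (simp add: S_def agree_def)
  qed
  moreover have "f = g" if "f = \<Phi> f" "g = \<Phi> g" for f g
  proof (rule mfps_eqI)
    fix m
    have "agree k f g" for k
    proof (induction k)
      case 0
      show ?case by (simp add: agree_def)
    next
      case (Suc k)
      from contr[OF this] that show ?case by simp
    qed
    from this[of "Suc (mdeg m)"] show "mcoeff f m = mcoeff g m"
      by (simp add: agree_def)
  qed
  ultimately have "\<exists>!S. S = \<Phi> S"
    by blast
  then show ?thesis
    by (simp add: \<Phi>_def)
qed

end

theory Submission
  imports Defs
begin

text \<open>
  The functional equation says \<open>S * A = S - 1\<close> for \<open>A = (\<Sum>n. t\<^sub>n S\<^sup>n\<^sup>-\<^sup>1)\<close>.  Telescoping the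
  geometric sums in \<open>B = (\<Sum>n. t\<^sub>n (1 + \<dots> + S\<^sup>n\<^sup>-\<^sup>1))\<close> gives \<open>(S - 1) * B = (S - 1) - S\<^sub>1\<close>, and
  shifting their exponents by one gives \<open>S * B = C + (S - 1)\<close>, where \<open>C\<close> is the series
  subtracted from \<open>1\<close> in the formula for \<open>H\<close>.  The rest is arithmetic in the field of fractions.
\<close>

text \<open>The support in the definition of \<open>mfps_infsum\<close> depends on the family; this
  puts the coefficients of several families over one common finite index set.\<close>

lemma mcoeff_infsum_superset:
  assumes "finite J" "J \<subseteq> I" "{i \<in> I. mcoeff (F i) m \<noteq> 0} \<subseteq> J"
  shows "mcoeff (mfps_infsum F I) m = (\<Sum>i\<in>J. mcoeff (F i) m)"
  unfolding mcoeff_infsum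
  by (rule sum.mono_neutral_left) (use assms in auto)

lemma mfps_infsum_add:
  assumes "mfps_summable F I" "mfps_summable G I"
  shows "mfps_infsum (\<lambda>i. F i + G i) I = mfps_infsum F I + mfps_infsum G I"
proof (rule mfps_eqI)
  fix m
  let ?J = "{i \<in> I. mcoeff (F i) m \<noteq> 0} \<union> {i \<in> I. mcoeff (G i) m \<noteq> 0}"
  have "finite ?J"
    using assms by (simp add: mfps_summable_def)
  then have "mcoeff (mfps_infsum K I) m = (\<Sum>i\<in>?J. mcoeff (K i) m)"
    if "{i \<in> I. mcoeff (K i) m \<noteq> 0} \<subseteq> ?J" for K
    using that by (intro mcoeff_infsum_superset) auto
  from this[of F] this[of G] this[of "\<lambda>i. F i + G i"]
  show "mcoeff (mfps_infsum (\<lambda>i. F i + G i) I) m = mcoeff (mfps_infsum F I + mfps_infsum G I) m"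
    by (force simp: sum.distrib)
qed

text \<open>A monomial has only finitely many splittings, and by summability each involves finitely
  many indices. One finite set \<open>J\<close> therefore serves all of them, and the two finite
  sums can be swapped.\<close>

lemma mfps_infsum_mult_left:
  fixes f :: "'a::comm_ring_1 mfps"
  assumes "mfps_summable F I"
  shows "mfps_infsum (\<lambda>i. f * F i) I = f * mfps_infsum F I"
proof (rule mfps_eqI)
  fix m
  define J where "J = (\<Union>p\<in>splits m. {i \<in> I. mcoeff (F i) (snd p) \<noteq> 0})"
  have J: "finite J" "J \<subseteq> I"
    using assms by (auto simp: J_def mfps_summable_def)
  have F: "mcoeff (mfps_infsum F I) (snd p) = (\<Sum>i\<in>J. mcoeff (F i) (snd p))"
    if "p \<in> splits m" for p
    by (rule mcoeff_infsum_superset[OF J]) (use that in \<open>auto simp: J_def\<close>)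
  have "{i \<in> I. mcoeff (f * F i) m \<noteq> 0} \<subseteq> J"
  proof
    fix i
    assume i: "i \<in> {i \<in> I. mcoeff (f * F i) m \<noteq> 0}"
    then obtain p where "p \<in> splits m" "mcoeff f (fst p) * mcoeff (F i) (snd p) \<noteq> 0"
      unfolding mcoeff_mult case_prod_unfold
      by (auto elim: sum.not_neutral_contains_not_neutral)
    with i show "i \<in> J"
      unfolding J_def by (intro UN_I[of p]) auto
  qed
  then have "mcoeff (mfps_infsum (\<lambda>i. f * F i) I) m = (\<Sum>i\<in>J. mcoeff (f * F i) m)"
    by (rule mcoeff_infsum_superset[OF J])
  also have "\<dots> = (\<Sum>p\<in>splits m. mcoeff f (fst p) * (\<Sum>i\<in>J. mcoeff (F i) (snd p)))"
    unfolding mcoeff_mult case_prod_unfold sum_distrib_left by (rule sum.swap)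
  also have "\<dots> = mcoeff (f * mfps_infsum F I) m"
    using F by (simp add: mcoeff_mult case_prod_unfold)
  finally show "mcoeff (mfps_infsum (\<lambda>i. f * F i) I) m = mcoeff (f * mfps_infsum F I) m" .
qed

lemma mfps_infsum_cong:
  "(\<And>i. i \<in> I \<Longrightarrow> F i = G i) \<Longrightarrow> mfps_infsum F I = mfps_infsum G I"
  by (rule mfps_eqI) (auto simp: mcoeff_infsum intro!: sum.cong)

lemma mfps_infsum_cong_neutral:
  assumes "I \<subseteq> J" "\<And>i. i \<in> J - I \<Longrightarrow> F i = 0"
  shows "mfps_infsum F I = mfps_infsum F J"
proof -
  have "i \<in> I \<and> mcoeff (F i) m \<noteq> 0 \<longleftrightarrow> i \<in> J \<and> mcoeff (F i) m \<noteq> 0" for i m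
    using assms by (cases "i \<in> I") auto
  then show ?thesis
    by (simp add: mfps_eq_iff mcoeff_infsum)
qed

text \<open>Families with a factor \<open>tvar n\<close> are always summable, so linearity holds
  here without side conditions.\<close>

lemma infsum_tvar_add:
  fixes F G :: "nat \<Rightarrow> 'a::comm_ring_1 mfps"
  shows "mfps_infsum (\<lambda>n. tvar n * (F n + G n)) I =
    mfps_infsum (\<lambda>n. tvar n * F n) I + mfps_infsum (\<lambda>n. tvar n * G n) I"
  by (simp add: distrib_left mfps_infsum_add mfps_summable_tvar_mult)

lemma infsum_tvar_mult_left:
  fixes f :: "'a::comm_ring_1 mfps"
  shows "mfps_infsum (\<lambda>n. tvar n * (f * F n)) I = f * mfps_infsum (\<lambda>n. tvar n * F n) I"
  by (simp add: mult.left_commute[of _ f] mfps_infsum_mult_left mfps_summable_tvar_mult)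

theorem theorem2p1:
  fixes S S1 :: "'a::idom mfps" and G H :: "'a mfps fract"
  assumes S: "S = 1 + mfps_infsum (\<lambda>n. tvar n * S ^ n) {1..}"
    and S1: "S1 = mfps_infsum tvar {1..}"
    and G: "G = to_fract (S - 1) / to_fract S1"
    and H: "H = G / to_fract S"
  shows "to_fract S = inverse (to_fract (1 - mfps_infsum (\<lambda>n. tvar n * S ^ (n - 1)) {1..})) \<and>
    inverse (to_fract (1 - mfps_infsum (\<lambda>n. tvar n * S ^ (n - 1)) {1..})) =
      1 / (1 - H * to_fract S1) \<and>
    G = inverse (to_fract (1 - mfps_infsum (\<lambda>n. tvar n * (\<Sum>k=0..n-1. S ^ k)) {1..})) \<and>
    H = inverse (to_fract (1 - mfps_infsum (\<lambda>n. tvar n * (\<Sum>k=1..n-1. S ^ k)) {2..}))"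
proof -
  define A where "A = mfps_infsum (\<lambda>n. tvar n * S ^ (n - 1)) {1..}"
  define B where "B = mfps_infsum (\<lambda>n. tvar n * (\<Sum>k=0..n-1. S ^ k)) {1..}"
  define C where "C = mfps_infsum (\<lambda>n. tvar n * (\<Sum>k=1..n-1. S ^ k)) {2..}"
  have C: "C = mfps_infsum (\<lambda>n. tvar n * (\<Sum>k=1..n-1. S ^ k)) {1..}"
    \<comment> \<open>At \<open>n = 1\<close> the inner sum is empty, so all three series can be
      indexed from 1.\<close>
    unfolding C_def by (rule mfps_infsum_cong_neutral) auto
  have SA: "S * (1 - A) = 1"
  proof -
    have "S * A = mfps_infsum (\<lambda>n. tvar n * S ^ n) {1..}"
      unfolding A_def infsum_tvar_mult_left[symmetric]
      by (rule mfps_infsum_cong) (simp flip: power_Suc)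
    with S show ?thesis
      by (simp add: algebra_simps)
  qed
  have SB: "(S - 1) * (1 - B) = S1"
  proof -
    have "(S - 1) * B + S1 = mfps_infsum (\<lambda>n. tvar n * ((S - 1) * (\<Sum>k=0..n-1. S ^ k) + 1)) {1..}"
      by (simp only: infsum_tvar_add infsum_tvar_mult_left B_def S1 mult_1_right)
    also have "\<dots> = mfps_infsum (\<lambda>n. tvar n * S ^ n) {1..}"
    proof (rule mfps_infsum_cong)
      fix n :: nat
      assume "n \<in> {1..}"
      \<comment> \<open>This fails at \<open>n = 0\<close>, where truncated subtraction gives
        \<open>{0..0}\<close>.\<close>
      then have "{0..n-1} = {..<n}"
        by auto
      then have "(S - 1) * (\<Sum>k=0..n-1. S ^ k) = S ^ n - 1"
        by (simp only: power_diff_1_eq)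
      then show "tvar n * ((S - 1) * (\<Sum>k=0..n-1. S ^ k) + 1) = tvar n * S ^ n"
        by simp
    qed
    also have "\<dots> = S - 1"
      using S by (simp add: algebra_simps)
    finally show ?thesis
      by (simp add: algebra_simps)
  qed
  have SC: "S * (1 - B) = 1 - C"
  proof -
    \<comment> \<open>The exponents \<open>0..n-1\<close> become \<open>1..n\<close>; the top terms
      are split off because they add up to \<open>S - 1\<close> by the functional equation.\<close>
    have "S * B = mfps_infsum (\<lambda>n. tvar n * ((\<Sum>k=1..n-1. S ^ k) + S ^ n)) {1..}"
      unfolding B_def infsum_tvar_mult_left[symmetric]
    proof (rule mfps_infsum_cong)
      fix n :: nat
      assume "n \<in> {1..}"
      then obtain j where "n = Suc j"
        by (cases n) auto
      then show "tvar n * (S * (\<Sum>k=0..n-1. S ^ k)) = tvar n * ((\<Sum>k=1..n-1. S ^ k) + S ^ n)"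
        by (simp add: sum_distrib_left sum.shift_bounds_cl_Suc_ivl[symmetric] flip: power_Suc)
    qed
    also have "\<dots> = C + (S - 1)"
      unfolding infsum_tvar_add C using S by (simp add: algebra_simps)
    finally show ?thesis
      by (simp add: algebra_simps)
  qed
  have "S1 \<noteq> 0"
    unfolding S1 by (rule infsum_tvar_nonzero)
  \<comment> \<open>By \<open>SA\<close>, \<open>S\<close> is a unit.\<close>
  moreover have "S \<noteq> 0"
    using SA by auto
  ultimately have nz: "to_fract S1 \<noteq> 0" "to_fract S \<noteq> 0"
    by simp_all
  have fS: "to_fract S * to_fract (1 - A) = 1"
    by (simp only: to_fract_mult[symmetric] SA to_fract_1)
  have fG: "G * to_fract (1 - B) = 1"
    using nz(1) by (simp only: G times_divide_eq_left to_fract_mult[symmetric] SB divide_self_if if_False)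
  have "H * (to_fract S * to_fract (1 - B)) = G * to_fract (1 - B)"
    using nz(2) by (simp only: H divide_inverse) (simp add: field_simps)
  with fG have fH: "H * to_fract (1 - C) = 1"
    by (simp only: SC[symmetric] to_fract_mult)
  \<comment> \<open>Cancelling \<open>S1\<close> leaves \<open>(S - 1) / S\<close>.\<close>
  have "H * to_fract S1 = 1 - inverse (to_fract S)"
    using nz by (simp add: H G field_simps)
  then have fA: "1 / (1 - H * to_fract S1) = to_fract S"
    by (simp add: divide_inverse)
  show ?thesis
    unfolding A_def[symmetric] B_def[symmetric] C_def[symmetric] fA
    \<comment> \<open>In a field, a product equal to 1 identifies each factor as the inverse of the
      other.\<close>
    using fS fG fH by (metis inverse_unique mult.commute)
qed

end
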